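(* For any positive integer $N$ the set $$\Bigl\{n^2 : n\in\mathbb{N},\ N \le n < N+ (8N+8)^{1/2}+2\Bigr\}$$ is a Sidon set. Moreover, the strict inequality "$<$" cannot be replaced by "$\le$", that is, there exist infinitely many positive integers $N$ such that the set $$\Bigl\{n^2 : n\in\mathbb{N},\ N \le n \le N+ (8N+8)^{1/2}+2\Bigr\}$$ is not a Sidon set.
   Context: $\mathbb{N}$ denotes the positive integers. A set $\mathcal{A}$ of integers is called a Sidon set if the equation $a_1+a_2=a_3+a_4$ with $a_1,a_2,a_3,a_4\in\mathcal{A}$ has only trivial solutions, i.e. every solution satisfies $\{a_1,a_2\}=\{a_3,a_4\}$. *)

theory Defs
  imports Complex_Main
begin

definition sidon :: "int set \<Rightarrow> bool" where
  "sidon A \<longleftrightarrow>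
     (\<forall>a1\<in>A. \<forall>a2\<in>A. \<forall>a3\<in>A. \<forall>a4\<in>A. a1 + a2 = a3 + a4 \<longrightarrow> {a1, a2} = {a3, a4})"

end

theory Submission
  imports Defs "HOL-Library.Infinite_Set"
begin

text \<open>
  Suppose \<open>a\<^sup>2 + b\<^sup>2 = c\<^sup>2 + d\<^sup>2\<close> is a nontrivial solution with least entry \<open>a\<close>. Then \<open>b\<close> is the
  largest entry. In \<open>(b - d) (b + d) = (c - a) (c + a)\<close> the factor \<open>b + d\<close> exceeds \<open>c + a\<close>, so
  \<open>b - d < c - a\<close>, that is \<open>c + d > a + b\<close>. Both sums have the same parity, because \<open>x\<^sup>2\<close> and \<open>x\<close> do, so
  \<open>c + d = a + b + 2 k\<close> with \<open>k \<ge> 1\<close>. Doubling the equation and subtracting the squares of the sums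
  turns it into a relation between the gaps,
  \<open>(b - a)\<^sup>2 = (d - c)\<^sup>2 + 4 k (a + b + k)\<close>. The right-hand side is smallest for \<open>d = c\<close> and \<open>k = 1\<close>,
  and completing the square then gives \<open>(b - a - 2)\<^sup>2 \<ge> 8 a + 8\<close>, so an interval starting at \<open>N \<le> a\<close>
  and containing \<open>b\<close> must reach \<open>N + sqrt (8 N + 8) + 2\<close>. This is
  \<open>gap_of_equal_sums_of_two_squares\<close>.

  The bound is attained when all these inequalities are equalities: \<open>a = N\<close>, \<open>c = d\<close>, \<open>k = 1\<close> and
  \<open>8 N + 8\<close> a square. Since \<open>16 t\<^sup>2 = 8 N + 8\<close> means \<open>N = 2 t\<^sup>2 - 1\<close>, this happens for infinitely
  many \<open>N\<close>; the solution is then \<open>N\<^sup>2 + (N + 4 t + 2)\<^sup>2 = 2 (N + 2 t + 2)\<^sup>2\<close>, used in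
  \<open>not_sidon_squares_closed_interval\<close>.
\<close>

text \<open>
  This is the gap estimate, in integers. The hypotheses single out \<open>a\<close> as the least entry without
  ordering \<open>c\<close> and \<open>d\<close>. The conclusion \<open>b - a > 2\<close> selects the positive square root.
\<close>

lemma gap_of_equal_sums_of_two_squares:
  fixes a b c d :: int
  assumes "0 \<le> a" "0 \<le> b" "a < c" "a < d" and eq: "a\<^sup>2 + b\<^sup>2 = c\<^sup>2 + d\<^sup>2"
  shows "b - a > 2" and "8 * a + 8 \<le> (b - a - 2)\<^sup>2"
proof -
  have "a\<^sup>2 < c\<^sup>2" "a\<^sup>2 < d\<^sup>2"
    using assms by (simp_all add: power_strict_mono)
  then have "c\<^sup>2 < b\<^sup>2" "d\<^sup>2 < b\<^sup>2"
    using eq by linarith+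
  then have "c < b" "d < b"
    using \<open>0 \<le> b\<close> by (auto intro: power2_less_imp_less)
  have factored: "(b - d) * (b + d) = (c - a) * (c + a)"
    using eq by (simp add: algebra_simps power2_eq_square)
  have "a + b < c + d"
  proof (rule ccontr)
    assume "\<not> a + b < c + d"
    then have "(c - a) * (c + a) \<le> (b - d) * (c + a)"
      using assms by (intro mult_right_mono) auto
    also have "\<dots> < (b - d) * (b + d)"
      using assms \<open>c < b\<close> \<open>d < b\<close> by (intro mult_strict_left_mono) auto
    finally show False
      using factored by simp
  qed
  moreover have "even (a + b) \<longleftrightarrow> even (c + d)"
    using arg_cong[OF eq, of even] by simp
  then have "even (c + d - (a + b))"
    by simp
  then obtain k where k: "c + d - (a + b) = 2 * k"
    by (rule evenE)
  ultimately have "k \<ge> 1"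
    by linarith
  have d: "d = a + b + 2 * k - c"
    using k by linarith
  have gaps: "(b - a)\<^sup>2 = (d - c)\<^sup>2 + 4 * (k * (a + b + k))"
    using eq unfolding d by (simp add: algebra_simps power2_eq_square)
  have "1 * (a + b + 1) \<le> k * (a + b + k)"
    using assms \<open>k \<ge> 1\<close> by (intro mult_mono) auto
  then have lower: "4 * (a + b + 1) \<le> (b - a)\<^sup>2"
    using gaps zero_le_power2[of "d - c"] by linarith
  then show "8 * a + 8 \<le> (b - a - 2)\<^sup>2"
    by (simp add: algebra_simps power2_eq_square)
  show "b - a > 2"
  proof (rule ccontr)
    assume "\<not> b - a > 2"
    then have "(b - a)\<^sup>2 \<le> 2\<^sup>2"
      using \<open>a < c\<close> \<open>c < b\<close> by (intro power_mono) auto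
    with lower show False
      using assms \<open>c < b\<close> by simp
  qed
qed

lemma no_lesser_entry_in_short_interval:
  fixes N a b c d :: nat
  assumes "N \<le> a" "real b < real N + sqrt (8 * real N + 8) + 2"
    and "a < c" "a < d"
  shows "(int a)\<^sup>2 + (int b)\<^sup>2 \<noteq> (int c)\<^sup>2 + (int d)\<^sup>2"
proof
  assume eq: "(int a)\<^sup>2 + (int b)\<^sup>2 = (int c)\<^sup>2 + (int d)\<^sup>2"
  note gap = gap_of_equal_sums_of_two_squares[OF _ _ _ _ eq]
  have "int b - int a > 2"
    using assms by (intro gap) auto
  moreover have "8 * int a + 8 \<le> (int b - int a - 2)\<^sup>2"
    using assms by (intro gap) auto
  then have "real_of_int (8 * int a + 8) \<le> real_of_int ((int b - int a - 2)\<^sup>2)"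
    by (simp only: of_int_le_iff)
  then have "8 * real a + 8 \<le> (real b - real a - 2)\<^sup>2"
    by simp
  then have "8 * real N + 8 \<le> (real b - real a - 2)\<^sup>2"
    using \<open>N \<le> a\<close> by (simp add: order_trans[rotated])
  ultimately have "sqrt (8 * real N + 8) \<le> real b - real a - 2"
    by (intro real_le_lsqrt) auto
  then show False
    using assms by simp
qed

lemma sidon_squares_short_interval:
  "sidon {(int n)^2 | n::nat. n > 0 \<and> N \<le> n \<and>
     real n < real N + sqrt (8 * real N + 8) + 2}"
  unfolding sidon_def
proof (safe del: equalityI, goal_cases)
  case (1 _ _ _ _ a b c d)
  \<comment> \<open>Any of the four entries may be the least one; the estimate excludes that it is less than both
    entries of the opposite side, so the two sides share an entry.\<close>
  have "\<not> (a < c \<and> a < d)" "\<not> (b < c \<and> b < d)" "\<not> (c < a \<and> c < b)" "\<not> (d < a \<and> d < b)"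
    using no_lesser_entry_in_short_interval[of N a b c d]
      no_lesser_entry_in_short_interval[of N b a c d]
      no_lesser_entry_in_short_interval[of N c d a b]
      no_lesser_entry_in_short_interval[of N d c a b] 1
    by (auto simp: add.commute)
  then have "a = c \<or> a = d \<or> b = c \<or> b = d"
    by linarith
  then show ?case
    using 1 by auto
qed

lemma not_sidon_squares_closed_interval:
  fixes t :: nat
  assumes "t > 0" and N: "N = 2 * t\<^sup>2 - 1"
  shows "\<not> sidon {(int n)^2 | n::nat. n > 0 \<and> N \<le> n \<and>
     real n \<le> real N + sqrt (8 * real N + 8) + 2}" (is "\<not> sidon ?A")
proof
  assume sidon: "sidon ?A"
  have "t\<^sup>2 > 0"
    using \<open>t > 0\<close> by simp
  then have "N > 0" and N': "N + 1 = 2 * t\<^sup>2"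
    unfolding N by linarith+
  have "8 * real N + 8 = 8 * real (N + 1)"
    by simp
  also have "\<dots> = (4 * real t)\<^sup>2"
    unfolding N' by (simp add: power2_eq_square)
  finally have root: "sqrt (8 * real N + 8) = 4 * real t"
    by (simp only: real_sqrt_abs)
  have mem: "(int n)\<^sup>2 \<in> ?A" if "N \<le> n" "n \<le> N + 4 * t + 2" for n
  proof -
    have "real n \<le> real (N + 4 * t + 2)"
      using that(2) by (simp only: of_nat_le_iff)
    then have "real n \<le> real N + sqrt (8 * real N + 8) + 2"
      unfolding root by simp
    then show ?thesis
      using that \<open>N > 0\<close> by auto
  qed
  have "int N = 2 * (int t)\<^sup>2 - 1"
    using arg_cong[OF N', of int] by simp
  then have "(int N)\<^sup>2 + (int (N + 4 * t + 2))\<^sup>2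
      = (int (N + 2 * t + 2))\<^sup>2 + (int (N + 2 * t + 2))\<^sup>2"
    by (simp add: algebra_simps power2_eq_square)
  moreover have "(int N)\<^sup>2 \<in> ?A" "(int (N + 4 * t + 2))\<^sup>2 \<in> ?A" "(int (N + 2 * t + 2))\<^sup>2 \<in> ?A"
    by (intro mem; simp)+
  ultimately have "{(int N)\<^sup>2, (int (N + 4 * t + 2))\<^sup>2}
      = {(int (N + 2 * t + 2))\<^sup>2, (int (N + 2 * t + 2))\<^sup>2}"
    using sidon unfolding sidon_def by blast
  then have "(int N)\<^sup>2 = (int (N + 2 * t + 2))\<^sup>2"
    by blast
  then show False
    by (simp add: power2_eq_iff)
qed

theorem theorem1:
  shows "(\<forall>N::nat. N > 0 \<longrightarrow>
            sidon {(int n)^2 | n::nat. n > 0 \<and> N \<le> n \<and>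
                     real n < real N + sqrt (8 * real N + 8) + 2})
         \<and> infinite {N::nat. N > 0 \<and>
            \<not> sidon {(int n)^2 | n::nat. n > 0 \<and> N \<le> n \<and>
                     real n \<le> real N + sqrt (8 * real N + 8) + 2}}"
    (is "?short \<and> infinite ?B")
proof
  show ?short
    using sidon_squares_short_interval by blast
  show "infinite ?B"
    unfolding infinite_nat_iff_unbounded_le
  proof
    fix m :: nat
    define N where "N = 2 * (Suc m)\<^sup>2 - 1"
    have "Suc m \<le> (Suc m)\<^sup>2"
      by (simp add: power2_eq_square)
    then have "m \<le> N" "N > 0"
      unfolding N_def by linarith+
    moreover have "\<not> sidon {(int n)^2 | n::nat. n > 0 \<and> N \<le> n \<and>
        real n \<le> real N + sqrt (8 * real N + 8) + 2}"
      by (rule not_sidon_squares_closed_interval[of "Suc m"]) (simp_all add: N_def)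
    ultimately show "\<exists>N\<ge>m. N \<in> ?B"
      by blast
  qed
qed

end
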